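(* Let $k\ge1$ be an integer and $a_1,\dots,a_k,b_1,\dots,b_k$ commuting variables. Set $z_k=a_1\cdots a_k$, $w_k=a_1b_1\cdots a_kb_k$, $x_k=a_1+a_1a_2+\cdots+a_1\cdots a_{k-1}$, $y_k=z_k(b_1+b_1b_2+\cdots+b_1\cdots b_{k-1})$. Then $$\sum_{\pi\in\mathcal{E}^k}\omega^k_\pi\big((a_i),(b_i)\big)=\frac{1}{(w_k;w_k)_\infty},\qquad \sum_{\pi\in\mathcal{S}^k}\omega^k_\pi\big((a_i),(b_i)\big)=\frac{(-x_k,-y_k;w_k)_\infty}{(z_k,w_k;w_k)_\infty},$$ $$\sum_{\pi\in\mathcal{DS}^k}\omega^k_\pi\big((a_i),(b_i)\big)=\frac{(-x_k,-y_k;w_k)_\infty}{(z_k;w_k)_\infty}.$$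
   Context: A partition $\pi$ is $k$-strict if for every $m\in\mathbb{N}$ and all $1\le r_1\le r_2\le k-1$, the numbers $mk+r_1$ and $mk+r_2$ do not appear together as parts of $\pi$ (so at most one part, counted with multiplicity, lies in each block $\{mk+1,\dots,mk+k-1\}$). $\mathcal{S}^k$ is the set of $k$-strict partitions; $\mathcal{DS}^k$ is the set of $k$-strict partitions into distinct parts; $\mathcal{E}^k$ is the set of partitions all of whose parts are $\equiv0\pmod k$ with each part occurring an even number of times. The weight $\omega^k_\pi((a_i),(b_i))$ is the product of labels obtained by labelling cells of each odd-indexed row of the Ferrers diagram of $\pi$ (top row has index 1) from left to right cyclically by $a_1,\dots,a_k$ and of each even-indexed row cyclically by $b_1,\dots,b_k$. Notation: $(a;q)_\infty=\prod_{i\ge1}(1-aq^{i-1})$ and $(a_1,\dots,a_m;q)_\infty=\prod_j(a_j;q)_\infty$; the identities are in formal power series. *)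

theory Defs
  imports "HOL-Analysis.Analysis" "HOL-Library.Multiset"
begin

section \<open>Formal power series in several commuting variables\<close>

text \<open>
  A monomial in the variables \<^typ>\<open>'v\<close> is a finite multiset of variables, multiplication of
  monomials being multiset sum. A formal power series is an arbitrary family of coefficients
  indexed by monomials.
\<close>

typedef ('v, 'a) mfps = "UNIV :: ('v multiset \<Rightarrow> 'a) set"
  morphisms mfps_nth Abs_mfps ..

lemma mfps_nth_Abs [simp]: "mfps_nth (Abs_mfps f) = f"
  by (simp add: Abs_mfps_inverse)

lemma mfps_eq_iff: "f = g \<longleftrightarrow> (\<forall>M. mfps_nth f M = mfps_nth g M)"
  by (metis ext mfps_nth_inject)

lemma mfps_eqI: "(\<And>M. mfps_nth f M = mfps_nth g M) \<Longrightarrow> f = g"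
  by (simp add: mfps_eq_iff)

definition mfps_var :: "'v \<Rightarrow> ('v, 'a::zero_neq_one) mfps" where
  "mfps_var v = Abs_mfps (\<lambda>M. if M = {#v#} then 1 else 0)"

definition msplits :: "'v multiset \<Rightarrow> ('v multiset \<times> 'v multiset) set" where
  "msplits M = {(P, Q). P + Q = M}"

lemma finite_msubsets: "finite {P. P \<subseteq># (M :: 'v multiset)}"
proof (induction M)
  case empty
  then show ?case by simp
next
  case (add x M)
  have "{P. P \<subseteq># add_mset x M} \<subseteq> {P. P \<subseteq># M} \<union> add_mset x ` {P. P \<subseteq># M}"
  proof
    fix P assume "P \<in> {P. P \<subseteq># add_mset x M}"
    then have P: "P \<subseteq># add_mset x M" by simp
    show "P \<in> {P. P \<subseteq># M} \<union> add_mset x ` {P. P \<subseteq># M}"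
    proof (cases "x \<in># P")
      case True
      then obtain P' where "P = add_mset x P'" by (meson mset_add)
      then show ?thesis using P by auto
    next
      case False
      have "count P y \<le> count M y" for y
        using mset_subset_eq_count[OF P, of y] False by (cases "y = x") (auto simp: not_in_iff)
      then have "P \<subseteq># M" by (simp add: subseteq_mset_def)
      then show ?thesis by simp
    qed
  qed
  then show ?case using add by (meson finite_Un finite_imageI finite_subset)
qed

lemma finite_msplits [simp]: "finite (msplits M)"
proof (rule finite_subset)
  show "msplits M \<subseteq> {P. P \<subseteq># M} \<times> {P. P \<subseteq># M}"
    by (auto simp: msplits_def)
  show "finite ({P. P \<subseteq># M} \<times> {P. P \<subseteq># M})"
    by (simp add: finite_msubsets)
qed

instantiation mfps :: (type, comm_ring_1) comm_ring_1
begin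

definition zero_mfps :: "('a, 'b) mfps" where
  "0 = Abs_mfps (\<lambda>_. 0)"

definition one_mfps :: "('a, 'b) mfps" where
  "1 = Abs_mfps (\<lambda>M. if M = {#} then 1 else 0)"

definition plus_mfps :: "('a, 'b) mfps \<Rightarrow> ('a, 'b) mfps \<Rightarrow> ('a, 'b) mfps" where
  "f + g = Abs_mfps (\<lambda>M. mfps_nth f M + mfps_nth g M)"

definition uminus_mfps :: "('a, 'b) mfps \<Rightarrow> ('a, 'b) mfps" where
  "- f = Abs_mfps (\<lambda>M. - mfps_nth f M)"

definition minus_mfps :: "('a, 'b) mfps \<Rightarrow> ('a, 'b) mfps \<Rightarrow> ('a, 'b) mfps" where
  "f - g = Abs_mfps (\<lambda>M. mfps_nth f M - mfps_nth g M)"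

definition times_mfps :: "('a, 'b) mfps \<Rightarrow> ('a, 'b) mfps \<Rightarrow> ('a, 'b) mfps" where
  "f * g = Abs_mfps (\<lambda>M. \<Sum>(P, Q)\<in>msplits M. mfps_nth f P * mfps_nth g Q)"

instance
proof
  fix f g h :: "('a, 'b) mfps"
  show "f * g * h = f * (g * h)"
  proof (rule mfps_eqI)
    fix M
    let ?F = "mfps_nth f" and ?G = "mfps_nth g" and ?H = "mfps_nth h"
    have "mfps_nth (f * g * h) M
        = (\<Sum>u\<in>msplits M. \<Sum>v\<in>msplits (fst u). ?F (fst v) * ?G (snd v) * ?H (snd u))"
      by (simp add: times_mfps_def sum_distrib_right case_prod_unfold)
    also have "\<dots> = (\<Sum>(u, v)\<in>(SIGMA u:msplits M. msplits (fst u)).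
                      ?F (fst v) * ?G (snd v) * ?H (snd u))"
      by (simp add: sum.Sigma)
    also have "\<dots> = (\<Sum>(u, v)\<in>(SIGMA u:msplits M. msplits (snd u)).
                      ?F (fst u) * (?G (fst v) * ?H (snd v)))"
      by (rule sum.reindex_bij_witness
            [where i = "\<lambda>(u, v). ((fst u + fst v, snd v), (fst u, fst v))"
               and j = "\<lambda>(u, v). ((fst v, snd v + snd u), (snd v, snd u))"])
         (auto simp: msplits_def add.assoc mult.assoc)
    also have "\<dots> = (\<Sum>u\<in>msplits M. \<Sum>v\<in>msplits (snd u). ?F (fst u) * (?G (fst v) * ?H (snd v)))"
      by (simp add: sum.Sigma)
    also have "\<dots> = mfps_nth (f * (g * h)) M"
      by (simp add: times_mfps_def sum_distrib_left case_prod_unfold)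
    finally show "mfps_nth (f * g * h) M = mfps_nth (f * (g * h)) M" .
  qed
  show "f * g = g * f"
  proof (rule mfps_eqI)
    fix M
    show "mfps_nth (f * g) M = mfps_nth (g * f) M"
      unfolding times_mfps_def mfps_nth_Abs
      by (rule sum.reindex_bij_witness[where i = "\<lambda>(P, Q). (Q, P)" and j = "\<lambda>(P, Q). (Q, P)"])
         (auto simp: msplits_def add.commute mult.commute)
  qed
  show "1 * f = f"
  proof (rule mfps_eqI)
    fix M
    have "mfps_nth (1 * f) M = (\<Sum>(P, Q)\<in>msplits M. if P = {#} then mfps_nth f Q else 0)"
      unfolding times_mfps_def one_mfps_def mfps_nth_Abs by (intro sum.cong) auto
    also have "\<dots> = (\<Sum>(P, Q)\<in>{({#} :: 'a multiset, M)}. if P = {#} then mfps_nth f Q else 0)"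
      by (rule sum.mono_neutral_right[OF finite_msplits]) (auto simp: msplits_def split: if_splits)
    finally show "mfps_nth (1 * f) M = mfps_nth f M" by simp
  qed
  show "(f + g) * h = f * h + g * h"
    by (rule mfps_eqI)
       (simp add: times_mfps_def plus_mfps_def distrib_right sum.distrib case_prod_unfold)
  show "(0 :: ('a, 'b) mfps) \<noteq> 1"
    by (auto simp: mfps_eq_iff zero_mfps_def one_mfps_def)
qed (simp_all add: mfps_eq_iff plus_mfps_def minus_mfps_def uminus_mfps_def zero_mfps_def ac_simps)

end

text \<open>The inverse of a unit; as usual, non-units are sent to \<open>0\<close>.\<close>

instantiation mfps :: (type, comm_ring_1) inverse
begin

definition inverse_mfps :: "('a, 'b) mfps \<Rightarrow> ('a, 'b) mfps" where
  "inverse (f :: ('a, 'b) mfps) = (if f dvd 1 then THE g. f * g = 1 else 0)"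

definition divide_mfps :: "('a, 'b) mfps \<Rightarrow> ('a, 'b) mfps \<Rightarrow> ('a, 'b) mfps" where
  "(f :: ('a, 'b) mfps) div g = f * inverse g"

instance ..

end

lemma mfps_inverse_unique:
  fixes f g :: "('v, 'a::comm_ring_1) mfps"
  assumes "f * g = 1"
  shows "inverse f = g"
proof -
  have "(THE h. f * h = 1) = g"
  proof (rule the_equality)
    fix h assume "f * h = 1"
    then have "h = h * (f * g)" "g = (f * h) * g" using assms by simp_all
    then show "h = g" by (simp add: mult.assoc mult.left_commute)
  qed (rule assms)
  then show ?thesis using assms by (auto simp: inverse_mfps_def dvd_def)
qed

text \<open>
  The topology of coefficientwise convergence with discrete coefficients. It gives infinite sums
  and products (\<^const>\<open>has_sum\<close>, \<^const>\<open>prodinf\<close>) their usual meaning for formal power series.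
\<close>

instantiation mfps :: (type, type) t2_space
begin

definition open_mfps :: "('a, 'b) mfps set \<Rightarrow> bool" where
  "open S \<longleftrightarrow> (\<forall>f\<in>S. \<exists>F. finite F \<and> {g. \<forall>M\<in>F. mfps_nth g M = mfps_nth f M} \<subseteq> S)"

instance
proof
  show "open (UNIV :: ('a, 'b) mfps set)"
    by (auto simp: open_mfps_def)
next
  fix S T :: "('a, 'b) mfps set"
  assume *: "open S" "open T"
  show "open (S \<inter> T)"
    unfolding open_mfps_def
  proof
    fix f assume f: "f \<in> S \<inter> T"
    obtain F where F: "finite F" "{g. \<forall>M\<in>F. mfps_nth g M = mfps_nth f M} \<subseteq> S"
      using *(1) f unfolding open_mfps_def by blast
    obtain G where G: "finite G" "{g. \<forall>M\<in>G. mfps_nth g M = mfps_nth f M} \<subseteq> T"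
      using *(2) f unfolding open_mfps_def by blast
    have "{g. \<forall>M\<in>F \<union> G. mfps_nth g M = mfps_nth f M} \<subseteq> S \<inter> T"
      using F(2) G(2) by blast
    then show "\<exists>F. finite F \<and> {g. \<forall>M\<in>F. mfps_nth g M = mfps_nth f M} \<subseteq> S \<inter> T"
      using F(1) G(1) by (meson finite_UnI)
  qed
next
  fix K :: "('a, 'b) mfps set set"
  assume *: "\<forall>S\<in>K. open S"
  show "open (\<Union>K)"
    unfolding open_mfps_def
  proof
    fix f assume "f \<in> \<Union>K"
    then obtain S where S: "S \<in> K" "f \<in> S" by blast
    then obtain F where "finite F" "{g. \<forall>M\<in>F. mfps_nth g M = mfps_nth f M} \<subseteq> S"
      using * unfolding open_mfps_def by blast
    then show "\<exists>F. finite F \<and> {g. \<forall>M\<in>F. mfps_nth g M = mfps_nth f M} \<subseteq> \<Union>K"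
      using S(1) by blast
  qed
next
  fix f g :: "('a, 'b) mfps"
  assume "f \<noteq> g"
  then obtain M where M: "mfps_nth f M \<noteq> mfps_nth g M"
    by (auto simp: mfps_eq_iff)
  have op: "open {h. mfps_nth h M = c}" for c :: 'b
    unfolding open_mfps_def by (intro ballI exI[of _ "{M}"]) auto
  have "{h. mfps_nth h M = mfps_nth f M} \<inter> {h. mfps_nth h M = mfps_nth g M} = {}"
    using M by auto
  then show "\<exists>U V. open U \<and> open V \<and> f \<in> U \<and> g \<in> V \<and> U \<inter> V = {}"
    using op by blast
qed

end

lemma tendsto_mfps_iff:
  fixes f :: "'c \<Rightarrow> ('v, 'a) mfps"
  shows "(f \<longlongrightarrow> l) F \<longleftrightarrow> (\<forall>M. \<forall>\<^sub>F x in F. mfps_nth (f x) M = mfps_nth l M)"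
proof
  assume lim: "(f \<longlongrightarrow> l) F"
  show "\<forall>M. \<forall>\<^sub>F x in F. mfps_nth (f x) M = mfps_nth l M"
  proof
    fix M
    have "open {h. mfps_nth h M = mfps_nth l M}"
      unfolding open_mfps_def by (intro ballI exI[of _ "{M}"]) auto
    then show "\<forall>\<^sub>F x in F. mfps_nth (f x) M = mfps_nth l M"
      using topological_tendstoD[OF lim] by fastforce
  qed
next
  assume ev: "\<forall>M. \<forall>\<^sub>F x in F. mfps_nth (f x) M = mfps_nth l M"
  show "(f \<longlongrightarrow> l) F"
  proof (rule topological_tendstoI)
    fix S :: "('v, 'a) mfps set" assume "open S" "l \<in> S"
    then obtain G where G: "finite G" "{g. \<forall>M\<in>G. mfps_nth g M = mfps_nth l M} \<subseteq> S"
      unfolding open_mfps_def by blast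
    have "\<forall>\<^sub>F x in F. \<forall>M\<in>G. mfps_nth (f x) M = mfps_nth l M"
      using ev G(1) by (simp add: eventually_ball_finite)
    then show "\<forall>\<^sub>F x in F. f x \<in> S"
      by eventually_elim (use G(2) in auto)
  qed
qed

definition qpoch_inf :: "'a::{t2_space, comm_ring_1} \<Rightarrow> 'a \<Rightarrow> 'a" where
  "qpoch_inf a q = (\<Prod>i. 1 - a * q ^ i)"


section \<open>Partitions\<close>

text \<open>
  A partition is the weakly decreasing list of its parts, so that \<open>p ! i\<close> is the length of row
  \<open>i + 1\<close> of the Ferrers diagram.
\<close>

definition is_partition :: "nat list \<Rightarrow> bool" where
  "is_partition p \<longleftrightarrow> sorted_wrt (\<ge>) p \<and> 0 \<notin> set p"

text \<open>
  Parts are compared at different positions \<open>i \<noteq> j\<close>; in the case \<open>r1 = r2\<close> this says that no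
  part that is not a multiple of \<open>k\<close> is repeated.
\<close>

definition k_strict :: "nat \<Rightarrow> nat list \<Rightarrow> bool" where
  "k_strict k p \<longleftrightarrow>
     (\<forall>m r1 r2. 1 \<le> r1 \<and> r1 \<le> r2 \<and> r2 \<le> k - 1 \<longrightarrow>
        \<not> (\<exists>i<length p. \<exists>j<length p. i \<noteq> j \<and> p ! i = m * k + r1 \<and> p ! j = m * k + r2))"

definition strict_partitions :: "nat \<Rightarrow> nat list set" where
  "strict_partitions k = {p. is_partition p \<and> k_strict k p}"

definition distinct_strict_partitions :: "nat \<Rightarrow> nat list set" where
  "distinct_strict_partitions k = {p. is_partition p \<and> k_strict k p \<and> distinct p}"

definition even_mult_partitions :: "nat \<Rightarrow> nat list set" where
  "even_mult_partitions k =
     {p. is_partition p \<and> (\<forall>n\<in>set p. k dvd n \<and> even (count_list p n))}"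

text \<open>
  List positions and columns are counted from \<open>0\<close>: the top row, labelled with \<open>a\<close>, is position \<open>0\<close>,
  and column \<open>j\<close> carries the label of index \<open>j mod k + 1\<close>.
\<close>

definition weight :: "nat \<Rightarrow> (nat \<Rightarrow> 'a) \<Rightarrow> (nat \<Rightarrow> 'a) \<Rightarrow> nat list \<Rightarrow> 'a::comm_monoid_mult" where
  "weight k a b p =
     (\<Prod>i<length p. \<Prod>j<p ! i. if even i then a (j mod k + 1) else b (j mod k + 1))"


text \<open>
  The indeterminates. Only those with index in \<open>{1..k}\<close> occur in identities for a given \<open>k\<close>;
  working in the power series ring in all of them allows \<open>k\<close> to vary.
\<close>

datatype indet = VarA nat | VarB nat

end

theory Submission
  imports Defs
begin

text \<open>
  Let \<open>A\<^sub>n\<close> be the weighted count of \<open>k\<close>-strict partitions with at most \<open>n\<close> parts. If such a partition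
  has exactly \<open>n + 1\<close> parts, then either its last part is at least \<open>k\<close>, and deleting the first \<open>k\<close>
  columns leaves an arbitrary \<open>k\<close>-strict partition with at most \<open>n + 1\<close> parts, or its last part is
  some \<open>r < k\<close>, in which case all other parts are at least \<open>k\<close>, and deleting the last part and the
  first \<open>k\<close> columns leaves an arbitrary \<open>k\<close>-strict partition with at most \<open>n\<close> parts. So
  \<open>A\<^sub>n\<^sub>+\<^sub>1 = A\<^sub>n + e\<^sub>n A\<^sub>n + f\<^sub>n\<^sub>+\<^sub>1 A\<^sub>n\<^sub>+\<^sub>1\<close>, where \<open>f\<^sub>1, f\<^sub>2, \<dots>\<close> runs through
  \<open>z, w, z w, w\<^sup>2, \<dots>\<close> and \<open>e\<^sub>0, e\<^sub>1, \<dots>\<close> through \<open>x, y, x w, y w, \<dots>\<close>, and the product for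
  \<open>S\<^sup>k\<close> follows in the limit.

  Two equal rows of length \<open>m k\<close> weigh \<open>w\<^sup>m\<close> wherever they stand, and deleting them does not change the
  labels of the other rows. Allowing repeated parts \<open>m k\<close> for one more value of \<open>m\<close> at a time therefore
  multiplies the sum by \<open>1 / (1 - w\<^sup>m)\<close>; this leads from \<open>DS\<^sup>k\<close> to \<open>S\<^sup>k\<close>, and from the empty
  partition to \<open>E\<^sup>k\<close>.
\<close>

section \<open>Convergence of formal power series\<close>

lemma nth_simps [simp]:
  fixes f g :: "('v, 'a::comm_ring_1) mfps"
  shows "mfps_nth (0 :: ('v, 'a) mfps) M = 0"
    "mfps_nth (1 :: ('v, 'a) mfps) M = (if M = {#} then 1 else 0)"
    "mfps_nth (f + g) M = mfps_nth f M + mfps_nth g M"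
    "mfps_nth (f - g) M = mfps_nth f M - mfps_nth g M"
    "mfps_nth (- f) M = - mfps_nth f M"
  by (simp_all add: zero_mfps_def one_mfps_def plus_mfps_def minus_mfps_def uminus_mfps_def)

lemma nth_mult:
  fixes f g :: "('v, 'a::comm_ring_1) mfps"
  shows "mfps_nth (f * g) M = (\<Sum>(P, Q)\<in>msplits M. mfps_nth f P * mfps_nth g Q)"
  by (simp add: times_mfps_def)

lemma tendsto_nth:
  fixes f :: "'c \<Rightarrow> ('v, 'a) mfps"
  shows "(f \<longlongrightarrow> l) F \<Longrightarrow> \<forall>\<^sub>F x in F. mfps_nth (f x) M = mfps_nth l M"
  by (simp add: tendsto_mfps_iff)

section \<open>Continuity of the ring operations\<close>

instance mfps :: (type, comm_ring_1) topological_comm_monoid_add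
proof
  fix f g :: "('a, 'b) mfps"
  have fst: "(fst \<longlongrightarrow> f) (nhds f \<times>\<^sub>F nhds g)" and snd: "(snd \<longlongrightarrow> g) (nhds f \<times>\<^sub>F nhds g)"
    by (rule filterlim_fst, rule filterlim_snd)
  show "((\<lambda>x. fst x + snd x) \<longlongrightarrow> f + g) (nhds f \<times>\<^sub>F nhds g)"
    unfolding tendsto_mfps_iff
  proof
    fix M
    from tendsto_nth[OF fst, of M] tendsto_nth[OF snd, of M]
    show "\<forall>\<^sub>F x in nhds f \<times>\<^sub>F nhds g. mfps_nth (fst x + snd x) M = mfps_nth (f + g) M"
      by eventually_elim simp
  qed
qed

text \<open>The coefficient of a product at \<open>M\<close> depends only on the finitely many
  coefficients indexed by \<open>msplits M\<close>.\<close>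

instance mfps :: (type, comm_ring_1) topological_comm_monoid_mult
proof
  fix f g :: "('a, 'b) mfps"
  have fst: "(fst \<longlongrightarrow> f) (nhds f \<times>\<^sub>F nhds g)" and snd: "(snd \<longlongrightarrow> g) (nhds f \<times>\<^sub>F nhds g)"
    by (rule filterlim_fst, rule filterlim_snd)
  show "((\<lambda>x. fst x * snd x) \<longlongrightarrow> f * g) (nhds f \<times>\<^sub>F nhds g)"
    unfolding tendsto_mfps_iff
  proof
    fix M :: "'a multiset"
    have "\<forall>\<^sub>F x in nhds f \<times>\<^sub>F nhds g. \<forall>s\<in>msplits M.
        mfps_nth (fst x) (fst s) = mfps_nth f (fst s) \<and>
        mfps_nth (snd x) (snd s) = mfps_nth g (snd s)"
      using tendsto_nth[OF fst] tendsto_nth[OF snd]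
      by (intro eventually_ball_finite ballI eventually_conj) auto
    then show "\<forall>\<^sub>F x in nhds f \<times>\<^sub>F nhds g. mfps_nth (fst x * snd x) M = mfps_nth (f * g) M"
      by eventually_elim (auto simp: nth_mult intro!: sum.cong)
  qed
qed

section \<open>Order of a series in total degree\<close>

definition vanishes_below :: "nat \<Rightarrow> ('v, 'a::comm_ring_1) mfps \<Rightarrow> bool" where
  "vanishes_below d f \<longleftrightarrow> (\<forall>M. size M < d \<longrightarrow> mfps_nth f M = 0)"

lemma vanishes_belowD: "vanishes_below d f \<Longrightarrow> size M < d \<Longrightarrow> mfps_nth f M = 0"
  by (simp add: vanishes_below_def)

lemma vanishes_below_mono: "vanishes_below d f \<Longrightarrow> e \<le> d \<Longrightarrow> vanishes_below e f"
  by (auto simp: vanishes_below_def)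

lemma vanishes_below_0 [simp]: "vanishes_below 0 f" "vanishes_below d 0"
  by (auto simp: vanishes_below_def)

lemma vanishes_below_var: "vanishes_below 1 (mfps_var v)"
  by (auto simp: vanishes_below_def mfps_var_def)

lemma vanishes_below_uminus: "vanishes_below d f \<Longrightarrow> vanishes_below d (- f)"
  by (auto simp: vanishes_below_def)

lemma vanishes_below_add: "vanishes_below d f \<Longrightarrow> vanishes_below d g \<Longrightarrow> vanishes_below d (f + g)"
  by (auto simp: vanishes_below_def)

lemma vanishes_below_sum: "(\<And>i. i \<in> I \<Longrightarrow> vanishes_below d (f i)) \<Longrightarrow> vanishes_below d (sum f I)"
  by (induction I rule: infinite_finite_induct) (auto intro: vanishes_below_add)

lemma vanishes_below_mult:
  fixes f g :: "('v, 'a::comm_ring_1) mfps"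
  assumes "vanishes_below d f" "vanishes_below e g"
  shows "vanishes_below (d + e) (f * g)"
  unfolding vanishes_below_def
proof (intro allI impI)
  fix M :: "'v multiset" assume M: "size M < d + e"
  show "mfps_nth (f * g) M = 0"
    unfolding nth_mult
  proof (rule sum.neutral, safe)
    fix P Q assume "(P, Q) \<in> msplits M"
    then have "size P + size Q < d + e" using M by (auto simp: msplits_def)
    then have "size P < d \<or> size Q < e" by linarith
    then show "mfps_nth f P * mfps_nth g Q = 0"
      using assms by (auto simp: vanishes_below_def)
  qed
qed

lemma vanishes_below_mult_left: "vanishes_below d f \<Longrightarrow> vanishes_below d (f * g)"
  using vanishes_below_mult[of d f 0 g] by simp

lemma vanishes_below_mult_right: "vanishes_below d g \<Longrightarrow> vanishes_below d (f * g)"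
  using vanishes_below_mult[of 0 f d g] by simp

lemma vanishes_below_prod:
  "finite I \<Longrightarrow> (\<And>i. i \<in> I \<Longrightarrow> vanishes_below (d i) (f i)) \<Longrightarrow> vanishes_below (sum d I) (prod f I)"
  by (induction I rule: finite_induct) (auto intro: vanishes_below_mult)

lemma vanishes_below_power: "vanishes_below 1 f \<Longrightarrow> vanishes_below n (f ^ n)"
  using vanishes_below_prod[of "{..<n}" "\<lambda>_. 1" "\<lambda>_. f"] by simp

text \<open>Each coefficient of the limit is attained by some \<open>f x\<close>, so a lower bound
  on the order is a closed condition.\<close>

lemma vanishes_below_limit:
  fixes l :: "('v, 'a::comm_ring_1) mfps"
  assumes "(f \<longlongrightarrow> l) F" "F \<noteq> bot" "\<forall>\<^sub>F x in F. vanishes_below d (f x)"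
  shows "vanishes_below d l"
  unfolding vanishes_below_def
proof (intro allI impI)
  fix M :: "'v multiset" assume M: "size M < d"
  have "\<forall>\<^sub>F x in F. mfps_nth l M = 0"
    using tendsto_nth[OF assms(1), of M] assms(3)
    by eventually_elim (use M in \<open>auto simp: vanishes_below_def\<close>)
  then show "mfps_nth l M = 0"
    using assms(2) by (simp add: eventually_const)
qed

lemma tendsto_vanishing_difference:
  fixes l :: "('v, 'a::comm_ring_1) mfps"
  assumes "\<And>n. vanishes_below n (l - f n)"
  shows "f \<longlonglongrightarrow> l"
  unfolding tendsto_mfps_iff
proof
  fix M :: "'v multiset"
  show "\<forall>\<^sub>F n in sequentially. mfps_nth (f n) M = mfps_nth l M"
    using eventually_gt_at_top[of "size M"]
    by eventually_elim (use assms vanishes_belowD in fastforce)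
qed

text \<open>The coefficient at \<open>M\<close> stops changing once the index exceeds
  \<open>size M\<close>; the limit is read off at \<open>Suc (size M)\<close>.\<close>

lemma convergent_vanishing_differences:
  fixes f :: "nat \<Rightarrow> ('v, 'a::comm_ring_1) mfps"
  assumes "\<And>n. vanishes_below n (f (Suc n) - f n)"
  shows "\<exists>l. f \<longlonglongrightarrow> l"
proof -
  define l where "l = Abs_mfps (\<lambda>M. mfps_nth (f (Suc (size M))) M)"
  have stable: "vanishes_below n (f (n + j) - f n)" for n j
  proof (induction j)
    case (Suc j)
    have "vanishes_below n (f (Suc (n + j)) - f (n + j))"
      using assms by (rule vanishes_below_mono) simp
    from vanishes_below_add[OF this Suc] show ?case by simp
  qed simp
  have l: "mfps_nth (f n) M = mfps_nth l M" if "size M < n" for n M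
    using vanishes_belowD[OF stable[of "Suc (size M)" "n - Suc (size M)"], of M] that
    by (simp add: l_def)
  have "f \<longlonglongrightarrow> l"
    unfolding tendsto_mfps_iff
    by (intro allI eventually_mono[OF eventually_gt_at_top] l)
  then show ?thesis ..
qed

section \<open>Units, quotients and infinite products\<close>

text \<open>The geometric series of \<open>1 - f\<close> converges, as its terms have growing order,
  and its sum inverts \<open>f\<close>.\<close>

lemma unit_of_vanishing:
  fixes f :: "('v, 'a::comm_ring_1) mfps"
  assumes "vanishes_below 1 (1 - f)"
  shows "f * inverse f = 1"
proof -
  define S where "S n = (\<Sum>i<n. (1 - f) ^ i)" for n
  obtain g where g: "S \<longlonglongrightarrow> g"
    using convergent_vanishing_differences[of S] vanishes_below_power[OF assms]
    by (auto simp: S_def)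
  have "f * S n = 1 - (1 - f) ^ n" for n
    using one_diff_power_eq[of "1 - f" n] by (simp add: S_def)
  then have "(\<lambda>n. f * S n) \<longlonglongrightarrow> 1"
    using vanishes_below_power[OF assms] by (intro tendsto_vanishing_difference) simp
  moreover have "(\<lambda>n. f * S n) \<longlonglongrightarrow> f * g"
    by (intro tendsto_mult tendsto_const g)
  ultimately have "f * g = 1" by (metis LIMSEQ_unique)
  then show ?thesis using mfps_inverse_unique by metis
qed

lemma divide_eqI:
  fixes f g h :: "('v, 'a::comm_ring_1) mfps"
  assumes "vanishes_below 1 (1 - g)" "h * g = f"
  shows "f / g = h"
  using unit_of_vanishing[OF assms(1)] assms(2)
  by (metis divide_mfps_def mult.assoc mult.right_neutral)

lemma vanishes_below_one_minus_prod:
  assumes "\<And>i. i \<in> I \<Longrightarrow> vanishes_below 1 (1 - f i)"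
  shows "vanishes_below 1 (1 - prod f I)"
  using assms
proof (induction I rule: infinite_finite_induct)
  case (insert i I)
  then have "vanishes_below 1 ((1 - f i) + f i * (1 - prod f I))"
    by (intro vanishes_below_add vanishes_below_mult_right) auto
  also have "(1 - f i) + f i * (1 - prod f I) = 1 - prod f (insert i I)"
    using insert.hyps by (simp add: algebra_simps)
  finally show ?case .
qed auto

lemma not_vanishes_below_one: "\<not> vanishes_below 1 (1 :: ('v, 'a::comm_ring_1) mfps)"
  by (auto simp: vanishes_below_def)

text \<open>Consecutive partial products differ by a multiple of \<open>q ^ n\<close>, so they
  converge; all have constant term 1, hence so does the limit.\<close>

lemma qpoch_inf_limit:
  fixes a q :: "('v, 'a::comm_ring_1) mfps"
  assumes a: "vanishes_below 1 a" and q: "vanishes_below 1 q"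
  shows "(\<lambda>n. \<Prod>i<n. 1 - a * q ^ i) \<longlonglongrightarrow> qpoch_inf a q"
    and "vanishes_below 1 (1 - qpoch_inf a q)"
proof -
  define f where "f i = 1 - a * q ^ i" for i
  define P where "P n = (\<Prod>i<n. f i)" for n
  have f1: "vanishes_below 1 (1 - f i)" for i
    using a by (simp add: f_def vanishes_below_mult_left)
  have "P (Suc n) - P n = - (P n * a * q ^ n)" for n
    by (simp add: P_def f_def algebra_simps)
  then have "vanishes_below n (P (Suc n) - P n)" for n
    using vanishes_below_power[OF q]
    by (auto intro!: vanishes_below_uminus vanishes_below_mult_right)
  then obtain l where l: "P \<longlonglongrightarrow> l"
    using convergent_vanishing_differences by blast
  have l1: "vanishes_below 1 (1 - l)"
  proof (rule vanishes_below_limit)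
    show "(\<lambda>n. 1 + (- 1) * P n) \<longlonglongrightarrow> 1 - l"
      using tendsto_add[OF tendsto_const[of 1] tendsto_mult[OF tendsto_const[of "-1"] l]] by simp
    show "\<forall>\<^sub>F n in sequentially. vanishes_below 1 (1 + (- 1) * P n)"
      using vanishes_below_one_minus_prod[of "{..<n}" f for n] f1 by (simp add: P_def)
  qed simp
  \<comment> \<open>\<open>has_prod\<close> asks for a nonzero limit, up to zero factors. Constant
    term 1 makes the limit and all factors nonzero, so \<open>prodinf\<close> is the plain
    limit.\<close>
  have nz: "g \<noteq> 0" if "vanishes_below 1 (1 - g)" for g :: "('v, 'a) mfps"
    using that not_vanishes_below_one by force
  have P': "(\<lambda>n. \<Prod>i\<le>n. f i) \<longlonglongrightarrow> l"
    using LIMSEQ_Suc[OF l] by (simp add: P_def lessThan_Suc_atMost)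
  have "prodinf f = l"
    unfolding prodinf_def
  proof (rule the_equality)
    show "f has_prod l"
      using P' nz[OF l1] by (simp add: has_prod_def raw_has_prod_def)
    fix p assume "f has_prod p"
    then show "p = l"
      using P' nz[OF f1] LIMSEQ_unique by (auto simp: has_prod_def raw_has_prod_def)
  qed
  then show "(\<lambda>n. \<Prod>i<n. 1 - a * q ^ i) \<longlonglongrightarrow> qpoch_inf a q" "vanishes_below 1 (1 - qpoch_inf a q)"
    using l l1 by (simp_all add: qpoch_inf_def f_def[abs_def] P_def[abs_def])
qed

section \<open>Summable families\<close>

text \<open>At a monomial \<open>M\<close> only the finitely many \<open>p\<close> with
  \<open>deg p \<le> size M\<close> can contribute.\<close>

lemma summable_on_of_degree:
  fixes f :: "'c \<Rightarrow> ('v, 'a::comm_ring_1) mfps"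
  assumes "\<And>p. p \<in> A \<Longrightarrow> vanishes_below (deg p) (f p)"
    and "\<And>d. finite {p \<in> A. deg p \<le> d}"
  shows "f summable_on A"
proof -
  define s where "s = Abs_mfps (\<lambda>M. \<Sum>p\<in>{p \<in> A. deg p \<le> size M}. mfps_nth (f p) M)"
  have nth_sum: "mfps_nth (sum f I) M = (\<Sum>p\<in>I. mfps_nth (f p) M)" for I M
    by (induction I rule: infinite_finite_induct) auto
  have "(sum f \<longlongrightarrow> s) (finite_subsets_at_top A)"
    unfolding tendsto_mfps_iff
  proof
    fix M :: "'v multiset"
    have "\<forall>\<^sub>F X in finite_subsets_at_top A. finite X \<and> {p \<in> A. deg p \<le> size M} \<subseteq> X \<and> X \<subseteq> A"
      unfolding eventually_finite_subsets_at_top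
      using assms(2) by (intro exI[of _ "{p \<in> A. deg p \<le> size M}"]) auto
    then show "\<forall>\<^sub>F X in finite_subsets_at_top A. mfps_nth (sum f X) M = mfps_nth s M"
    proof eventually_elim
      case (elim X)
      have "(\<Sum>p\<in>X. mfps_nth (f p) M) = (\<Sum>p\<in>{p \<in> A. deg p \<le> size M}. mfps_nth (f p) M)"
        using elim assms(1)
        by (intro sum.mono_neutral_right) (auto simp: vanishes_below_def subset_iff not_le)
      then show ?case by (simp add: nth_sum s_def)
    qed
  qed
  then show ?thesis by (auto simp: summable_on_def has_sum_def)
qed

lemma vanishes_below_infsum:
  assumes "f summable_on A" "\<And>p. p \<in> A \<Longrightarrow> vanishes_below d (f p)"
  shows "vanishes_below d (infsum f A)"
proof (rule vanishes_below_limit)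
  show "(sum f \<longlongrightarrow> infsum f A) (finite_subsets_at_top A)"
    using has_sum_infsum[OF assms(1)] by (simp add: has_sum_def)
  show "\<forall>\<^sub>F X in finite_subsets_at_top A. vanishes_below d (sum f X)"
    using eventually_finite_subsets_at_top_weakI[of A "\<lambda>X. vanishes_below d (sum f X)"] assms(2)
    by (auto intro!: vanishes_below_sum)
qed simp


section \<open>Partitions and their weights\<close>

text \<open>Merges the order of the list with strictness, so that \<open>sorted_wrt\<close> carries
  both; \<open>u div k\<close> numbers the block of \<open>u\<close>.\<close>

definition strict_rel :: "nat \<Rightarrow> nat \<Rightarrow> nat \<Rightarrow> bool" where
  "strict_rel k u v \<longleftrightarrow> v \<le> u \<and> (k dvd u \<or> k dvd v \<or> u div k \<noteq> v div k)"

lemma k_strict_iff_sorted_wrt: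
  assumes "k \<ge> 1"
  shows "sorted_wrt (\<ge>) p \<and> k_strict k p \<longleftrightarrow> sorted_wrt (strict_rel k) p"
proof
  assume p: "sorted_wrt (\<ge>) p \<and> k_strict k p"
  show "sorted_wrt (strict_rel k) p"
    unfolding sorted_wrt_iff_nth_less
  proof (intro allI impI)
    fix i j assume ij: "i < j" "j < length p"
    define u v where "u = p ! i" and "v = p ! j"
    have "v \<le> u" using p ij by (auto simp: sorted_wrt_iff_nth_less u_def v_def)
    moreover have False if "\<not> k dvd u" "\<not> k dvd v" "u div k = v div k"
    proof -
      have uv: "u = v div k * k + u mod k" "v = v div k * k + v mod k"
        using that(3) by (metis div_mult_mod_eq, simp)
      have "1 \<le> v mod k" using that(2) by (simp add: dvd_eq_mod_eq_0 Suc_le_eq)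
      moreover have "v mod k \<le> u mod k" using \<open>v \<le> u\<close> uv by linarith
      moreover have "u mod k \<le> k - 1"
        using mod_less_divisor[of k u] assms by linarith
      \<comment> \<open>\<open>k_strict\<close> names the smaller residue first, so the later part
        \<open>v\<close> takes the role of \<open>r1\<close> and the positions are
        exchanged.\<close>
      ultimately have "\<not> (\<exists>i<length p. \<exists>j<length p. i \<noteq> j \<and>
          p ! i = v div k * k + v mod k \<and> p ! j = v div k * k + u mod k)"
        using p unfolding k_strict_def by blast
      moreover have "j < length p" "i < length p" "j \<noteq> i"
          "p ! j = v div k * k + v mod k" "p ! i = v div k * k + u mod k"
        using ij uv by (auto simp: u_def v_def)
      ultimately show False by blast
    qed
    ultimately show "strict_rel k (p ! i) (p ! j)" by (auto simp: strict_rel_def u_def v_def)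
  qed
next
  assume p: "sorted_wrt (strict_rel k) p"
  have "sorted_wrt (\<ge>) p"
    by (rule sorted_wrt_mono_rel[OF _ p]) (simp add: strict_rel_def)
  moreover have "k_strict k p"
    unfolding k_strict_def
  proof (intro allI impI notI, elim exE conjE)
    fix m r1 r2 i j
    assume r: "1 \<le> r1" "r1 \<le> r2" "r2 \<le> k - 1" and ij: "i < length p" "j < length p" "i \<noteq> j"
      and eq: "p ! i = m * k + r1" "p ! j = m * k + r2"
    have r': "r1 < k" "r2 < k" using r assms by linarith+
    have "\<not> k dvd p ! i" "\<not> k dvd p ! j" "p ! i div k = p ! j div k"
      using r r' by (auto simp: eq dvd_add_right_iff dest: dvd_imp_le)
    then have "\<not> strict_rel k (p ! i) (p ! j)" "\<not> strict_rel k (p ! j) (p ! i)"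
      by (auto simp: strict_rel_def)
    then show False
      using p ij by (metis nat_neq_iff sorted_wrt_iff_nth_less)
  qed
  ultimately show "sorted_wrt (\<ge>) p \<and> k_strict k p" ..
qed

lemma strict_partitions_eq:
  "k \<ge> 1 \<Longrightarrow> strict_partitions k = {p. sorted_wrt (strict_rel k) p \<and> 0 \<notin> set p}"
  using k_strict_iff_sorted_wrt[of k] by (auto simp: strict_partitions_def is_partition_def)

lemma sorted_wrt_strict_rel_imp_ge: "sorted_wrt (strict_rel k) p \<Longrightarrow> sorted_wrt (\<ge>) p"
  by (erule sorted_wrt_mono_rel[rotated]) (simp add: strict_rel_def)

section \<open>Insertion of a pair of equal parts\<close>

lemma filter_append_filter_sorted:
  fixes c :: nat
  assumes "sorted_wrt (\<ge>) p"
  shows "filter (\<lambda>n. n > c) p @ filter (\<lambda>n. n \<le> c) p = p"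
  using assms
proof (induction p)
  case (Cons n p)
  show ?case
  proof (cases "n > c")
    case False
    with Cons.prems have "filter (\<lambda>n. n > c) p = []" "filter (\<lambda>n. n \<le> c) p = p"
      by (auto simp: filter_empty_conv filter_id_conv)
    with False show ?thesis by simp
  qed (use Cons in auto)
qed simp

text \<open>The pair goes ahead of parts already equal to \<open>c\<close>, so the same two filters
  read back the old list.\<close>

definition insert_pair :: "nat \<Rightarrow> nat list \<Rightarrow> nat list" where
  "insert_pair c p = filter (\<lambda>n. n > c) p @ c # c # filter (\<lambda>n. n \<le> c) p"

lemma count_list_insert_pair:
  "count_list (insert_pair c p) n = count_list p n + (if n = c then 2 else 0)"
proof -
  have "count_list (filter (\<lambda>n. n > c) p) n + count_list (filter (\<lambda>n. n \<le> c) p) n = count_list p n"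
    by (induction p) auto
  then show ?thesis by (auto simp: insert_pair_def)
qed

lemma set_insert_pair: "set (insert_pair c p) = insert c (set p)"
  by (auto simp: insert_pair_def)

lemma inj_on_insert_pair: "inj_on (insert_pair c) {p. sorted_wrt (\<ge>) p}"
proof (rule inj_onI)
  fix p q assume pq: "p \<in> {p. sorted_wrt (\<ge>) p}" "q \<in> {p. sorted_wrt (\<ge>) p}"
    and eq: "insert_pair c p = insert_pair c q"
  have "filter (\<lambda>n. n > c) (insert_pair c p) = filter (\<lambda>n. n > c) p"
    "filter (\<lambda>n. n \<le> c) (insert_pair c p) = c # c # filter (\<lambda>n. n \<le> c) p" for p
    by (simp_all add: insert_pair_def filter_empty_conv)
  with eq have "filter (\<lambda>n. n > c) p = filter (\<lambda>n. n > c) q" "filter (\<lambda>n. n \<le> c) p = filter (\<lambda>n. n \<le> c) q"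
    by (metis, metis list.inject)
  then show "p = q" using filter_append_filter_sorted pq by (metis mem_Collect_eq)
qed

text \<open>A multiple of \<open>k\<close> shares a block restriction with no part, itself included,
  so only the order matters for the new pair.\<close>

lemma sorted_insert_pair:
  assumes "sorted_wrt (strict_rel k) p" "k dvd c"
  shows "sorted_wrt (strict_rel k) (insert_pair c p)"
proof -
  have "sorted_wrt (strict_rel k) (filter (\<lambda>n. n > c) p @ filter (\<lambda>n. n \<le> c) p)"
    using assms(1) filter_append_filter_sorted[OF sorted_wrt_strict_rel_imp_ge[OF assms(1)]] by simp
  then show ?thesis
    using assms(2) by (auto simp: insert_pair_def sorted_wrt_append strict_rel_def)
qed

text \<open>Equal entries of a decreasing list are adjacent, so the first \<open>c\<close> is
  followed at once by another; deleting both gives \<open>q\<close>.\<close>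

lemma insert_pair_surj:
  assumes p: "sorted_wrt (strict_rel k) p" and c: "count_list p c \<ge> 2"
  obtains q where "p = insert_pair c q" "sorted_wrt (strict_rel k) q"
proof -
  have "c \<in> set p" using c count_notin by force
  then obtain p1 p' where p1: "p = p1 @ c # p'" "c \<notin> set p1"
    by (meson split_list_first)
  have "c \<in> set p'" using c p1 count_notin[of c p1] count_notin[of c p'] by fastforce
  then obtain d p2 where p2: "p' = d # p2" by (cases p') auto
  have srt: "sorted_wrt (\<ge>) (p1 @ c # d # p2)"
    using sorted_wrt_strict_rel_imp_ge p p1 p2 by auto
  have d: "d = c" using \<open>c \<in> set p'\<close> srt p2 by (auto simp: sorted_wrt_append)
  have "\<forall>n\<in>set p1. n > c" using srt p1(2) by (auto simp: sorted_wrt_append) (metis le_neq_implies_less)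
  moreover have "\<forall>n\<in>set p2. n \<le> c" using srt by (auto simp: sorted_wrt_append)
  ultimately have "filter (\<lambda>n. n > c) p1 = p1" "filter (\<lambda>n. n \<le> c) p1 = []"
    "filter (\<lambda>n. n > c) p2 = []" "filter (\<lambda>n. n \<le> c) p2 = p2"
    by (simp_all add: filter_id_conv filter_empty_conv not_le not_less)
  then have "insert_pair c (p1 @ p2) = p"
    using p1 p2 d by (simp add: insert_pair_def)
  moreover have "sorted_wrt (strict_rel k) (p1 @ p2)"
    using p p1 p2 by (auto simp: sorted_wrt_append)
  ultimately show ?thesis using that by metis
qed

section \<open>Weights of rows and of blocks of columns\<close>

definition row_weight :: "nat \<Rightarrow> (nat \<Rightarrow> 'a) \<Rightarrow> nat \<Rightarrow> 'a::comm_monoid_mult" where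
  "row_weight k c n = (\<Prod>j<n. c (j mod k + 1))"

lemma row_weight_0 [simp]: "row_weight k c 0 = 1"
  by (simp add: row_weight_def)

text \<open>Within the first \<open>k\<close> columns the cyclic labels do not wrap around.\<close>

lemma row_weight_eq_prod:
  assumes "n \<le> k"
  shows "row_weight k c n = (\<Prod>i=1..n. c i)"
  unfolding row_weight_def
  using assms by (intro prod.reindex_bij_witness[of _ "\<lambda>i. i - 1" Suc]) auto

lemma row_weight_add_period:
  "row_weight k c (n + k) = row_weight k c k * row_weight k c n"
proof (induction n)
  case (Suc n)
  then show ?case by (simp add: row_weight_def ac_simps)
qed simp

lemma row_weight_mult_period: "row_weight k c (m * k) = row_weight k c k ^ m"
  by (induction m) (simp_all add: row_weight_add_period[of k c "m * k" for m, simplified add.commute])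

lemma weight_eq_row_weight:
  "weight k a b p = (\<Prod>i<length p. row_weight k (if even i then a else b) (p ! i))"
  by (auto simp: weight_def row_weight_def intro!: prod.cong)

lemma weight_Nil [simp]: "weight k a b [] = 1"
  by (simp add: weight_def)

text \<open>Removing the top row changes the parity of all other rows, so the two label families
  trade places.\<close>

lemma weight_Cons [simp]: "weight k a b (n # p) = row_weight k a n * weight k b a p"
  by (auto simp: weight_eq_row_weight prod.lessThan_Suc_shift simp del: prod.lessThan_Suc
      intro!: prod.cong arg_cong2[of _ _ _ _ "(*)"])

lemma weight_snoc:
  "weight k a b (p @ [n]) = weight k a b p * row_weight k (if even (length p) then a else b) n"
  by (auto simp: weight_eq_row_weight nth_append intro!: prod.cong)

lemma weight_append_zeros: "weight k a b (p @ replicate j 0) = weight k a b p"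
proof (induction j)
  case (Suc j)
  then show ?case
    using weight_snoc[of k a b "p @ replicate j 0" 0] by (simp add: replicate_append_same)
qed simp

text \<open>Rows below the pair move by two and keep their labels. Each row in front exchanges
  \<open>a\<close> and \<open>b\<close>, hence the generalised induction; the factor of the pair is
  symmetric in them.\<close>

lemma weight_pair:
  "weight k a b (p @ c # c # q) = row_weight k a c * row_weight k b c * weight k a b (p @ q)"
  by (induction p arbitrary: a b) (simp_all add: ac_simps)

lemma weight_insert_pair:
  assumes "sorted_wrt (\<ge>) p"
  shows "weight k a b (insert_pair c p) = row_weight k a c * row_weight k b c * weight k a b p"
  using assms by (simp add: insert_pair_def weight_pair filter_append_filter_sorted)

text \<open>The weight of a rectangle with \<open>n\<close> rows and \<open>k\<close> columns, which
  is the factor \<open>f\<^sub>n\<close> of the overview for \<open>n \<ge> 1\<close>.\<close>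

definition column_block :: "nat \<Rightarrow> (nat \<Rightarrow> 'a) \<Rightarrow> (nat \<Rightarrow> 'a) \<Rightarrow> nat \<Rightarrow> 'a::comm_monoid_mult" where
  "column_block k a b n = (\<Prod>i<n. row_weight k (if even i then a else b) k)"

lemma column_block_even:
  "column_block k a b (2 * m) = (row_weight k a k * row_weight k b k) ^ m"
  by (induction m) (simp_all add: column_block_def ac_simps)

lemma column_block_odd:
  "column_block k a b (Suc (2 * m)) = row_weight k a k * (row_weight k a k * row_weight k b k) ^ m"
  using column_block_even[of k a b m] by (simp add: column_block_def ac_simps)

text \<open>Labels have period \<open>k\<close> along a row, so the first \<open>k\<close> columns
  can be removed without relabelling the rest.\<close>

lemma weight_map_add:
  "weight k a b (map (\<lambda>n. n + k) p) = column_block k a b (length p) * weight k a b p"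
  by (auto simp: weight_eq_row_weight column_block_def row_weight_add_period simp flip: prod.distrib)

text \<open>Padding a partition with zero parts lets the removal of the first \<open>k\<close> columns keep the
  number of rows.\<close>

definition padded_strict :: "nat \<Rightarrow> nat \<Rightarrow> nat list set" where
  "padded_strict k n = {p. length p = n \<and> sorted_wrt (strict_rel k) p}"

section \<open>Decomposition by the last entry\<close>

lemma strict_rel_add_period: "k \<ge> 1 \<Longrightarrow> strict_rel k (u + k) (v + k) \<longleftrightarrow> strict_rel k u v"
  by (auto simp: strict_rel_def)

text \<open>\<open>r\<close> occupies block 0, so an earlier entry, being at least \<open>r\<close>,
  has to lie beyond that block.\<close>

lemma strict_rel_small: "0 < r \<Longrightarrow> r < k \<Longrightarrow> strict_rel k u r \<longleftrightarrow> k \<le> u"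
  by (auto simp: strict_rel_def dvd_imp_le div_eq_0_iff dest: dvd_imp_le not_le_imp_less)

lemma map_add_diff: "\<forall>n\<in>set p. (k::nat) \<le> n \<Longrightarrow> map (\<lambda>n. n + k) (map (\<lambda>n. n - k) p) = p"
  by (induction p) auto

lemma padded_strict_large_iff:
  assumes "k \<ge> 1"
  shows "p \<in> map (\<lambda>n. n + k) ` padded_strict k n \<longleftrightarrow> p \<in> padded_strict k n \<and> (\<forall>u\<in>set p. k \<le> u)"
proof
  assume "p \<in> padded_strict k n \<and> (\<forall>u\<in>set p. k \<le> u)"
  then have p: "map (\<lambda>n. n + k) (map (\<lambda>n. n - k) p) = p" "length p = n" "sorted_wrt (strict_rel k) p"
    by (auto simp: map_add_diff padded_strict_def simp del: map_map)
  then have "sorted_wrt (strict_rel k) (map (\<lambda>n. n + k) (map (\<lambda>n. n - k) p))" by metis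
  then have "map (\<lambda>n. n - k) p \<in> padded_strict k n"
    using p(2) assms unfolding sorted_wrt_map by (simp add: padded_strict_def strict_rel_add_period sorted_wrt_map)
  then show "p \<in> map (\<lambda>n. n + k) ` padded_strict k n" using p(1) by (metis image_eqI)
qed (use assms in \<open>auto simp: padded_strict_def sorted_wrt_map strict_rel_add_period\<close>)

text \<open>The last entry is 0, or lies strictly between 0 and \<open>k\<close> and forces all
  others to be at least \<open>k\<close>, or is at least \<open>k\<close> like all entries before
  it.\<close>

lemma padded_strict_Suc:
  assumes "k \<ge> 1"
  shows "padded_strict k (Suc n) = (\<lambda>p. p @ [0]) ` padded_strict k n \<union>
    (\<Union>r\<in>{1..k-1}. (\<lambda>p. map (\<lambda>n. n + k) p @ [r]) ` padded_strict k n) \<union>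
    map (\<lambda>n. n + k) ` padded_strict k (Suc n)" (is "?L = ?A \<union> ?B \<union> ?C")
proof -
  have zero: "strict_rel k u 0" for u by (simp add: strict_rel_def)
  have mem_snoc: "q @ [r] \<in> ?L \<longleftrightarrow> q \<in> padded_strict k n \<and> (\<forall>u\<in>set q. strict_rel k u r)" for q r
    by (auto simp: padded_strict_def sorted_wrt_append)
  have "p \<in> ?L \<longleftrightarrow> p \<in> ?A \<union> ?B \<union> ?C" for p
  proof (cases p rule: rev_cases)
    case Nil
    then show ?thesis by (auto simp: padded_strict_def)
  next
    case (snoc q r)
    have A: "p \<in> ?A \<longleftrightarrow> q \<in> padded_strict k n \<and> r = 0" using snoc by auto
    have "p \<in> ?B \<longleftrightarrow> q \<in> map (\<lambda>n. n + k) ` padded_strict k n \<and> 0 < r \<and> r < k"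
      using snoc by auto
    then have B: "p \<in> ?B \<longleftrightarrow> q \<in> padded_strict k n \<and> (\<forall>u\<in>set q. k \<le> u) \<and> 0 < r \<and> r < k"
      by (simp add: padded_strict_large_iff[OF assms])
    have C: "p \<in> ?C \<longleftrightarrow> p \<in> ?L \<and> (\<forall>u\<in>set p. k \<le> u)"
      by (rule padded_strict_large_iff[OF assms])
    have L: "p \<in> ?L \<longleftrightarrow> q \<in> padded_strict k n \<and> (\<forall>u\<in>set q. strict_rel k u r)"
      using mem_snoc snoc by simp
    consider "r = 0" | "0 < r" "r < k" | "k \<le> r" by linarith
    then show ?thesis
    proof cases
      case 1
      then have "p \<in> ?L \<longleftrightarrow> p \<in> ?A" using A L by (simp add: zero)
      then show ?thesis using B C 1 by blast
    next
      case 2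
      with A B C L show ?thesis using snoc by (simp add: strict_rel_small)
    next
      case 3
      then have "p \<in> ?L \<Longrightarrow> \<forall>u\<in>set p. k \<le> u"
        using L snoc by (force simp: strict_rel_def)
      with 3 A B C show ?thesis using assms by auto
    qed
  qed
  then show ?thesis by blast
qed


section \<open>Generating functions\<close>

lemma vanishes_below_row_weight:
  fixes c :: "nat \<Rightarrow> ('v, 'a::comm_ring_1) mfps"
  assumes "\<And>i. vanishes_below 1 (c i)"
  shows "vanishes_below n (row_weight k c n)"
  using vanishes_below_prod[of "{..<n}" "\<lambda>_. 1" "\<lambda>j. c (j mod k + 1)"] assms
  by (simp add: row_weight_def)

lemma vanishes_below_weight:
  fixes a b :: "nat \<Rightarrow> ('v, 'a::comm_ring_1) mfps"
  assumes "\<And>i. vanishes_below 1 (a i)" "\<And>i. vanishes_below 1 (b i)"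
  shows "vanishes_below (sum_list p) (weight k a b p)"
  using assms
proof (induction p arbitrary: a b)
  case (Cons n p)
  then show ?case
    by (simp add: vanishes_below_mult vanishes_below_row_weight)
qed simp

text \<open>With \<open>sum_list\<close> as degree, this is what makes the weights over
  \<open>A\<close> summable.\<close>

definition finite_degrees :: "nat list set \<Rightarrow> bool" where
  "finite_degrees A \<longleftrightarrow> (\<forall>d. finite {p \<in> A. sum_list p \<le> d})"

lemma finite_degrees_subset: "finite_degrees A \<Longrightarrow> B \<subseteq> A \<Longrightarrow> finite_degrees B"
  unfolding finite_degrees_def
  by (rule allI, rule finite_subset[of _ "{p \<in> A. sum_list p \<le> d}" for d]) auto

text \<open>Entries are at most \<open>d\<close> and lengths at most \<open>n + d\<close>. The slack
  \<open>n\<close> admits the zeros of padded lists.\<close>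

lemma finite_degreesI:
  assumes "\<And>p. p \<in> A \<Longrightarrow> length p \<le> n + sum_list p"
  shows "finite_degrees A"
  unfolding finite_degrees_def
proof
  fix d
  have "{p \<in> A. sum_list p \<le> d} \<subseteq> {p. set p \<subseteq> {..d} \<and> length p \<le> n + d}"
    using assms by (fastforce dest: member_le_sum_list)
  then show "finite {p \<in> A. sum_list p \<le> d}"
    by (rule finite_subset) (simp add: finite_lists_length_le)
qed

lemma length_le_sum_list: "0 \<notin> set p \<Longrightarrow> length p \<le> sum_list (p :: nat list)"
  by (induction p) auto

lemma finite_degrees_no_zero: "finite_degrees {p. 0 \<notin> set p}"
  by (rule finite_degreesI[of _ 0]) (simp add: length_le_sum_list)

lemma finite_degrees_padded_strict: "finite_degrees (padded_strict k n)"
  by (rule finite_degreesI[of _ n]) (simp add: padded_strict_def)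

lemma recurrence_collect:
  fixes s t u :: "'r::comm_ring_1"
  assumes "u = s + t * u"
  shows "u * (1 - t) = s"
proof -
  have "u * (1 - t) = u - t * u" by (simp add: algebra_simps)
  also have "\<dots> = s" using assms by (metis add_diff_cancel_right')
  finally show ?thesis .
qed

text \<open>Labels are kept as abstract series without constant term; the order of a weight is then
  at least the size of the partition.\<close>

locale row_labels =
  fixes k :: nat and a b :: "nat \<Rightarrow> ('v, 'a::comm_ring_1) mfps"
  assumes k_pos: "k \<ge> 1"
    and a_vanishes: "\<And>i. vanishes_below 1 (a i)"
    and b_vanishes: "\<And>i. vanishes_below 1 (b i)"
begin

definition gf :: "nat list set \<Rightarrow> ('v, 'a) mfps" where
  "gf A = infsum (weight k a b) A"

definition z :: "('v, 'a) mfps" where "z = row_weight k a k"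
definition w :: "('v, 'a) mfps" where "w = row_weight k a k * row_weight k b k"
definition x :: "('v, 'a) mfps" where "x = (\<Sum>r=1..k-1. row_weight k a r)"
definition y :: "('v, 'a) mfps" where "y = z * (\<Sum>r=1..k-1. row_weight k b r)"

lemma summable_weight: "finite_degrees A \<Longrightarrow> weight k a b summable_on A"
  using vanishes_below_weight[of a b, OF a_vanishes b_vanishes]
  by (intro summable_on_of_degree[where deg = sum_list]) (auto simp: finite_degrees_def)

lemma has_sum_gf: "finite_degrees A \<Longrightarrow> (weight k a b has_sum gf A) A"
  unfolding gf_def by (intro has_sum_infsum summable_weight)

lemma gf_Un:
  assumes "finite_degrees (A \<union> B)" "A \<inter> B = {}"
  shows "gf (A \<union> B) = gf A + gf B"
  unfolding gf_def
  using assms finite_degrees_subset by (intro infsum_Un_disjoint summable_weight) blast+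

lemma gf_UN:
  assumes "finite I" "finite_degrees (\<Union>(A ` I))" "disjoint_family_on A I"
  shows "gf (\<Union>(A ` I)) = (\<Sum>i\<in>I. gf (A i))"
  using assms
proof (induction I rule: finite_induct)
  case empty
  then show ?case by (simp add: gf_def)
next
  case (insert i I)
  have "gf (A i \<union> \<Union>(A ` I)) = gf (A i) + gf (\<Union>(A ` I))"
    using insert.prems insert.hyps by (intro gf_Un) (auto simp: disjoint_family_on_def)
  moreover have "gf (\<Union>(A ` I)) = (\<Sum>i\<in>I. gf (A i))"
    using insert.prems
    by (intro insert.IH) (auto intro: finite_degrees_subset simp: disjoint_family_on_def)
  ultimately show ?case using insert.hyps by simp
qed

lemma gf_image:
  assumes "finite_degrees A" "inj_on h A" "\<And>p. p \<in> A \<Longrightarrow> weight k a b (h p) = c * weight k a b p"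
  shows "gf (h ` A) = c * gf A"
proof -
  have "gf (h ` A) = infsum (\<lambda>p. c * weight k a b p) A"
    unfolding gf_def infsum_reindex[OF assms(2)] using assms(3) by (intro infsum_cong) simp
  then show ?thesis
    unfolding gf_def using summable_weight[OF assms(1)] by (simp add: infsum_cmult_right)
qed

text \<open>Members of \<open>S\<close> outside \<open>A n\<close> have weights of order at least
  \<open>n\<close>, and so has the difference of the two sums.\<close>

lemma gf_tendsto:
  assumes "finite_degrees S" "\<And>n. A n \<subseteq> S" "\<And>n p. p \<in> S - A n \<Longrightarrow> n \<le> sum_list p"
  shows "(\<lambda>n. gf (A n)) \<longlonglongrightarrow> gf S"
proof (rule tendsto_vanishing_difference)
  fix n
  have "gf (A n \<union> (S - A n)) = gf (A n) + gf (S - A n)"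
    using assms(1,2) by (intro gf_Un) (auto intro: finite_degrees_subset)
  moreover have "A n \<union> (S - A n) = S" using assms(2) by auto
  ultimately have "gf S - gf (A n) = gf (S - A n)" by simp
  also have "vanishes_below n \<dots>"
    unfolding gf_def
  proof (intro vanishes_below_infsum summable_weight)
    show "finite_degrees (S - A n)"
      using assms(1) by (rule finite_degrees_subset) auto
    fix p assume "p \<in> S - A n"
    then show "vanishes_below n (weight k a b p)"
      using vanishes_below_mono[OF vanishes_below_weight[of a b, OF a_vanishes b_vanishes] assms(3)] by blast
  qed
  finally show "vanishes_below n (gf S - gf (A n))" .
qed

lemma vanishes_below_zwxy:
  "vanishes_below 1 z" "vanishes_below 1 w" "vanishes_below 1 x" "vanishes_below 1 y"
proof -
  have row: "vanishes_below 1 (row_weight k a r)" if "r \<ge> 1" for r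
    using vanishes_below_mono[OF vanishes_below_row_weight[OF a_vanishes] that] .
  show "vanishes_below 1 z" "vanishes_below 1 w" "vanishes_below 1 x" "vanishes_below 1 y"
    using row k_pos
    by (auto simp: z_def w_def x_def y_def intro!: vanishes_below_mult_left vanishes_below_sum)
qed

lemma row_weights_multiple: "row_weight k a (m * k) * row_weight k b (m * k) = w ^ m"
  by (simp add: row_weight_mult_period w_def power_mult_distrib)

section \<open>The product for strict partitions\<close>

text \<open>One summand for each class of \<open>padded_strict_Suc\<close>. The last of
  \<open>n + 1\<close> rows stands at position \<open>n\<close>, so it is labelled by
  \<open>a\<close> exactly when \<open>n\<close> is even.\<close>

lemma gf_padded_Suc:
  "gf (padded_strict k (Suc n)) = gf (padded_strict k n)
    + column_block k a b n * (\<Sum>r=1..k-1. row_weight k (if even n then a else b) r) * gf (padded_strict k n)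
    + column_block k a b (Suc n) * gf (padded_strict k (Suc n))"
proof -
  let ?P = "padded_strict k n" and ?Q = "padded_strict k (Suc n)"
  define A where "A = (\<lambda>p. p @ [0]) ` ?P"
  define B where "B r = (\<lambda>p. map (\<lambda>n. n + k) p @ [r]) ` ?P" for r
  define C where "C = map (\<lambda>n. n + k) ` ?Q"
  have Q: "?Q = A \<union> \<Union>(B ` {1..k-1}) \<union> C"
    unfolding A_def B_def C_def by (rule padded_strict_Suc[OF k_pos])
  have inj_map: "inj_on (map (\<lambda>n. n + k)) X" for X
    by (rule inj_on_subset[OF inj_mapI]) (auto simp: inj_def)
  have large: "\<forall>u\<in>set p. k \<le> u" "p \<noteq> []" if "p \<in> C" for p
    using that by (auto simp: C_def padded_strict_def)
  have disj: "A \<inter> \<Union>(B ` {1..k-1}) = {}" "(A \<union> \<Union>(B ` {1..k-1})) \<inter> C = {}"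
    using k_pos by (auto simp: A_def B_def dest: large)
  have fin: "finite_degrees ?Q" "finite_degrees ?P"
    by (rule finite_degrees_padded_strict)+
  have gf_B: "gf (B r) = column_block k a b n * row_weight k (if even n then a else b) r * gf ?P" for r
    unfolding B_def using fin(2)
  proof (rule gf_image)
    show "inj_on (\<lambda>p. map (\<lambda>n. n + k) p @ [r]) ?P"
      using inj_map[of ?P] by (auto simp: inj_on_def)
  qed (auto simp: weight_snoc weight_map_add padded_strict_def ac_simps)
  have "gf ?Q = gf (A \<union> \<Union>(B ` {1..k-1})) + gf C"
    using fin(1) disj(2) unfolding Q by (rule gf_Un)
  also have "gf (A \<union> \<Union>(B ` {1..k-1})) = gf A + gf (\<Union>(B ` {1..k-1}))"
    using disj(1) fin(1) by (intro gf_Un) (auto intro: finite_degrees_subset simp: Q)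
  also have "gf (\<Union>(B ` {1..k-1})) = (\<Sum>r=1..k-1. gf (B r))"
    using fin(1)
    by (intro gf_UN) (auto intro: finite_degrees_subset simp: Q disjoint_family_on_def B_def)
  also have "\<dots> = column_block k a b n * (\<Sum>r=1..k-1. row_weight k (if even n then a else b) r) * gf ?P"
    by (simp only: gf_B sum_distrib_left sum_distrib_right)
  also have "gf A = gf ?P"
    using gf_image[OF fin(2), of "\<lambda>p. p @ [0]" 1] by (auto simp: A_def weight_snoc inj_on_def)
  also have "gf C = column_block k a b (Suc n) * gf ?Q"
    unfolding C_def using fin(1) by (rule gf_image) (auto simp: inj_map weight_map_add padded_strict_def)
  finally show ?thesis .
qed

text \<open>Each induction step applies the recurrence twice, gaining
  \<open>(1 + x * w ^ m) / (1 - z * w ^ m)\<close> and then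
  \<open>(1 + y * w ^ m) / (1 - w ^ (m + 1))\<close>.\<close>

lemma gf_padded_product:
  "gf (padded_strict k (2 * m)) * ((\<Prod>i<m. 1 - z * w ^ i) * (\<Prod>i<m. 1 - w * w ^ i)) =
    (\<Prod>i<m. 1 - (- x) * w ^ i) * (\<Prod>i<m. 1 - (- y) * w ^ i)"
proof (induction m)
  case 0
  have "padded_strict k 0 = {[]}" by (auto simp: padded_strict_def)
  then show ?case by (simp add: gf_def)
next
  case (Suc m)
  let ?A = "\<lambda>n. gf (padded_strict k n)"
  have "?A (2 * m + 1) * (1 - column_block k a b (Suc (2 * m))) =
      ?A (2 * m) + column_block k a b (2 * m) * x * ?A (2 * m)"
    using recurrence_collect[OF gf_padded_Suc[of "2 * m"]] by (simp add: x_def)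
  then have odd: "?A (2 * m + 1) * (1 - z * w ^ m) = ?A (2 * m) * (1 - (- x) * w ^ m)"
    unfolding column_block_even column_block_odd w_def[symmetric] unfolding z_def[symmetric]
    by (simp add: algebra_simps)
  have "?A (2 * m + 2) * (1 - column_block k a b (2 * Suc m)) =
      ?A (2 * m + 1) + column_block k a b (Suc (2 * m)) * (\<Sum>r=1..k-1. row_weight k b r) * ?A (2 * m + 1)"
    using recurrence_collect[OF gf_padded_Suc[of "Suc (2 * m)"]] by simp
  \<comment> \<open>The \<open>z\<close> from \<open>column_block_odd\<close> is absorbed into
    \<open>y\<close>.\<close>
  then have even: "?A (2 * m + 2) * (1 - w * w ^ m) = ?A (2 * m + 1) * (1 - (- y) * w ^ m)"
    unfolding column_block_even column_block_odd y_def w_def[symmetric] unfolding z_def[symmetric]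
    by (simp add: algebra_simps)
  let ?Z = "\<Prod>i<m. 1 - z * w ^ i" and ?W = "\<Prod>i<m. 1 - w * w ^ i"
  have "?A (2 * Suc m) * ((\<Prod>i<Suc m. 1 - z * w ^ i) * (\<Prod>i<Suc m. 1 - w * w ^ i)) =
      (?A (2 * m + 2) * (1 - w * w ^ m)) * (1 - z * w ^ m) * (?Z * ?W)"
    by (simp add: ac_simps)
  also have "\<dots> = (?A (2 * m + 1) * (1 - z * w ^ m)) * (1 - (- y) * w ^ m) * (?Z * ?W)"
    unfolding even by (simp only: ac_simps)
  also have "\<dots> = (?A (2 * m) * (?Z * ?W)) * (1 - (- x) * w ^ m) * (1 - (- y) * w ^ m)"
    unfolding odd by (simp only: ac_simps)
  also note Suc
  finally show ?case by (simp add: ac_simps)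
qed

text \<open>Zero rows have weight 1 and stand at the end of a decreasing list, so padding is a
  weight-preserving bijection.\<close>

lemma gf_padded_eq:
  "gf (padded_strict k n) = gf {p \<in> strict_partitions k. length p \<le> n}"
proof -
  let ?S = "{p \<in> strict_partitions k. length p \<le> n}" and ?pad = "\<lambda>p. p @ replicate (n - length p) (0::nat)"
  have S: "strict_partitions k = {p. sorted_wrt (strict_rel k) p \<and> 0 \<notin> set p}"
    by (rule strict_partitions_eq[OF k_pos])
  have "padded_strict k n = ?pad ` ?S"
  proof (intro equalityI subsetI)
    fix p assume p: "p \<in> padded_strict k n"
    define q where "q = filter (\<lambda>n. n > 0) p"
    define r where "r = filter (\<lambda>n. n \<le> 0) p"
    have eq: "q @ r = p"
      using p filter_append_filter_sorted[of p 0] sorted_wrt_strict_rel_imp_ge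
      by (auto simp: q_def r_def padded_strict_def)
    have "r = replicate (length r) 0"
      by (rule replicate_eqI) (auto simp: r_def)
    moreover have "length r = n - length q" using p by (auto simp: padded_strict_def simp flip: eq)
    ultimately have pad: "p = ?pad q" using eq by simp
    have "q \<in> ?S"
      using p by (auto simp: S q_def padded_strict_def sorted_wrt_filter)
    with pad show "p \<in> ?pad ` ?S" by (rule image_eqI)
  next
    fix p assume "p \<in> ?pad ` ?S"
    then obtain q where q: "q \<in> ?S" "p = ?pad q" by blast
    have "sorted_wrt (strict_rel k) (replicate j 0)" for j
      by (induction j) (auto simp: strict_rel_def)
    with q show "p \<in> padded_strict k n"
      by (auto simp: padded_strict_def S sorted_wrt_append) (auto simp: strict_rel_def)
  qed
  also have "gf (?pad ` ?S) = 1 * gf ?S"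
  proof (rule gf_image)
    show "inj_on ?pad ?S"
    proof (rule inj_on_inverseI)
      fix p assume "p \<in> ?S"
      then show "filter (\<lambda>n. n > 0) (?pad p) = p"
        by (auto simp: S filter_id_conv intro!: Nat.gr0I)
    qed
    show "finite_degrees ?S"
      by (rule finite_degrees_subset[OF finite_degrees_no_zero]) (auto simp: S)
  qed (simp add: weight_append_zeros)
  finally show ?thesis by simp
qed

lemma finite_degrees_strict_partitions: "finite_degrees (strict_partitions k)"
  by (rule finite_degrees_subset[OF finite_degrees_no_zero])
     (auto simp: strict_partitions_def is_partition_def)

text \<open>The limit of \<open>gf_padded_product\<close>; a partition with more than
  \<open>n\<close> parts has size above \<open>n\<close>, so it does not affect low orders.\<close>

lemma gf_strict_product:
  "gf (strict_partitions k) * (qpoch_inf z w * qpoch_inf w w) = qpoch_inf (- x) w * qpoch_inf (- y) w"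
proof (rule LIMSEQ_unique)
  note v = vanishes_below_zwxy
  have "(\<lambda>n. gf (padded_strict k n)) \<longlonglongrightarrow> gf (strict_partitions k)"
    unfolding gf_padded_eq
  proof (rule gf_tendsto[OF finite_degrees_strict_partitions])
    fix n p assume "p \<in> strict_partitions k - {p \<in> strict_partitions k. length p \<le> n}"
    then show "n \<le> sum_list p"
      using length_le_sum_list[of p] by (auto simp: strict_partitions_def is_partition_def)
  qed auto
  \<comment> \<open>The product formula speaks of even numbers of rows, hence the
    subsequence.\<close>
  from LIMSEQ_subseq_LIMSEQ[OF this, of "\<lambda>m. 2 * m"]
  have "(\<lambda>m. gf (padded_strict k (2 * m))) \<longlonglongrightarrow> gf (strict_partitions k)"
    by (auto simp: strict_mono_def o_def)
  then show "(\<lambda>m. gf (padded_strict k (2 * m)) * ((\<Prod>i<m. 1 - z * w ^ i) * (\<Prod>i<m. 1 - w * w ^ i)))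
      \<longlonglongrightarrow> gf (strict_partitions k) * (qpoch_inf z w * qpoch_inf w w)"
    by (intro tendsto_mult qpoch_inf_limit v)
  show "(\<lambda>m. gf (padded_strict k (2 * m)) * ((\<Prod>i<m. 1 - z * w ^ i) * (\<Prod>i<m. 1 - w * w ^ i)))
      \<longlonglongrightarrow> qpoch_inf (- x) w * qpoch_inf (- y) w"
    unfolding gf_padded_product
    by (intro tendsto_mult qpoch_inf_limit v vanishes_below_uminus)
qed

text \<open>The filtration that interpolates between \<open>distinct_strict_partitions k\<close> at \<open>m = 0\<close> and
  \<open>strict_partitions k\<close>.\<close>

definition repeats_upto :: "nat \<Rightarrow> nat list set" where
  "repeats_upto m = {p \<in> strict_partitions k. \<forall>j>m. count_list p (j * k) \<le> 1}"

section \<open>From strict partitions to distinct parts\<close>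

text \<open>A repeated part of a strict partition is a positive multiple of \<open>k\<close>, so
  bounding the multiplicity of these forces distinctness.\<close>

lemma repeats_upto_0: "repeats_upto 0 = distinct_strict_partitions k"
proof -
  have "distinct p \<longleftrightarrow> (\<forall>j>0. count_list p (j * k) \<le> 1)" if p: "p \<in> strict_partitions k" for p
  proof
    assume "distinct p"
    then have "count_list p n \<le> 1" for n by (induction p) auto
    then show "\<forall>j>0. count_list p (j * k) \<le> 1" by simp
  next
    assume *: "\<forall>j>0. count_list p (j * k) \<le> 1"
    show "distinct p"
    proof (rule ccontr)
      assume "\<not> distinct p"
      then obtain xs ys zs c where c: "p = xs @ [c] @ ys @ [c] @ zs"
        using not_distinct_decomp by blast
      have "k dvd c"
        using p unfolding strict_partitions_eq[OF k_pos] c by (auto simp: sorted_wrt_append strict_rel_def)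
      then obtain j where j: "c = j * k" by (metis dvd_def mult.commute)
      have "c \<noteq> 0" using p c by (auto simp: strict_partitions_eq[OF k_pos])
      then have "j > 0" using j by (cases j) auto
      then have "count_list p c \<le> 1" using * j by blast
      then show False by (simp add: c)
    qed
  qed
  then show ?thesis
    by (auto simp: repeats_upto_def distinct_strict_partitions_def strict_partitions_def)
qed

text \<open>Partitions with at least two parts \<open>c = Suc m * k\<close> arise from all of level
  \<open>Suc m\<close> by inserting a pair, which multiplies weights by \<open>w ^ Suc m\<close>;
  the others form level \<open>m\<close>.\<close>

lemma gf_repeats_Suc: "gf (repeats_upto (Suc m)) * (1 - w * w ^ m) = gf (repeats_upto m)"
proof -
  define c where "c = Suc m * k"
  have S: "strict_partitions k = {p. sorted_wrt (strict_rel k) p \<and> 0 \<notin> set p}"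
    by (rule strict_partitions_eq[OF k_pos])
  have c: "k dvd c" "0 < c" using k_pos by (auto simp: c_def)
  have image: "{p \<in> repeats_upto (Suc m). count_list p c \<ge> 2} = insert_pair c ` repeats_upto (Suc m)"
  proof (intro equalityI subsetI)
    fix p assume p: "p \<in> {p \<in> repeats_upto (Suc m). count_list p c \<ge> 2}"
    then obtain q where q: "p = insert_pair c q" "sorted_wrt (strict_rel k) q"
      using insert_pair_surj[of k p c] by (auto simp: repeats_upto_def S)
    have "q \<in> repeats_upto (Suc m)"
      using p q by (auto simp: repeats_upto_def S set_insert_pair count_list_insert_pair split: if_splits)
    then show "p \<in> insert_pair c ` repeats_upto (Suc m)" using q by blast
  next
    fix p assume "p \<in> insert_pair c ` repeats_upto (Suc m)"
    then obtain q where q: "p = insert_pair c q" "q \<in> repeats_upto (Suc m)" by blast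
    have "j * k \<noteq> c" if "j > Suc m" for j using that k_pos by (simp add: c_def del: mult_Suc)
    with q show "p \<in> {p \<in> repeats_upto (Suc m). count_list p c \<ge> 2}"
      using c by (auto simp: repeats_upto_def S set_insert_pair count_list_insert_pair sorted_insert_pair)
  qed
  have "(\<forall>j>m. count_list p (j * k) \<le> 1) \<longleftrightarrow>
      count_list p c \<le> 1 \<and> (\<forall>j>Suc m. count_list p (j * k) \<le> 1)" for p
    unfolding c_def by (metis Suc_lessI lessI Suc_lessD)
  then have mem: "p \<in> repeats_upto m \<longleftrightarrow> p \<in> repeats_upto (Suc m) \<and> count_list p c \<le> 1" for p
    by (simp add: repeats_upto_def conj_ac)
  have split: "repeats_upto (Suc m) = repeats_upto m \<union> insert_pair c ` repeats_upto (Suc m)"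
    unfolding image[symmetric] set_eq_iff Un_iff mem mem_Collect_eq by linarith
  have disj: "repeats_upto m \<inter> insert_pair c ` repeats_upto (Suc m) = {}"
    unfolding image[symmetric] disjoint_iff mem mem_Collect_eq by simp
  have fin: "finite_degrees (repeats_upto (Suc m))"
    by (rule finite_degrees_subset[OF finite_degrees_strict_partitions]) (auto simp: repeats_upto_def)
  have srt: "sorted_wrt (\<ge>) p" if "p \<in> repeats_upto (Suc m)" for p
    using that sorted_wrt_strict_rel_imp_ge by (auto simp: repeats_upto_def S)
  have "gf (repeats_upto (Suc m)) = gf (repeats_upto m) + gf (insert_pair c ` repeats_upto (Suc m))"
    using gf_Un[OF _ disj] fin unfolding split[symmetric] .
  also have "gf (insert_pair c ` repeats_upto (Suc m)) = (w * w ^ m) * gf (repeats_upto (Suc m))"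
    using fin
  proof (rule gf_image)
    show "inj_on (insert_pair c) (repeats_upto (Suc m))"
      using srt by (intro inj_on_subset[OF inj_on_insert_pair]) auto
  qed (simp add: weight_insert_pair srt c_def row_weights_multiple del: mult_Suc)
  finally show ?thesis by (rule recurrence_collect)
qed

text \<open>A strict partition outside level \<open>m\<close> contains some \<open>j * k\<close>
  with \<open>j > m\<close>, so the levels converge to all strict partitions, while the factors
  telescope down to level 0.\<close>

lemma gf_strict_distinct:
  "gf (strict_partitions k) * qpoch_inf w w = gf (distinct_strict_partitions k)"
proof (rule LIMSEQ_unique)
  have "(\<lambda>m. gf (repeats_upto m)) \<longlonglongrightarrow> gf (strict_partitions k)"
  proof (rule gf_tendsto[OF finite_degrees_strict_partitions])
    fix m p assume "p \<in> strict_partitions k - repeats_upto m"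
    then obtain j where j: "j > m" "count_list p (j * k) > 1" by (auto simp: repeats_upto_def not_le)
    then have "j * k \<in> set p" using count_notin by force
    then have "j * k \<le> sum_list p" by (auto intro: member_le_sum_list)
    moreover have "j \<le> j * k" using k_pos by simp
    ultimately show "m \<le> sum_list p" using j(1) by linarith
  qed (auto simp: repeats_upto_def)
  then show "(\<lambda>m. gf (repeats_upto m) * (\<Prod>i<m. 1 - w * w ^ i)) \<longlonglongrightarrow> gf (strict_partitions k) * qpoch_inf w w"
    by (intro tendsto_mult qpoch_inf_limit vanishes_below_zwxy)
  have "gf (repeats_upto m) * (\<Prod>i<m. 1 - w * w ^ i) = gf (repeats_upto 0)" for m
  proof (induction m)
    case (Suc m)
    have "gf (repeats_upto (Suc m)) * (\<Prod>i<Suc m. 1 - w * w ^ i) =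
        (gf (repeats_upto (Suc m)) * (1 - w * w ^ m)) * (\<Prod>i<m. 1 - w * w ^ i)"
      by (simp add: ac_simps)
    with Suc show ?case by (simp add: gf_repeats_Suc del: prod.lessThan_Suc)
  qed simp
  then show "(\<lambda>m. gf (repeats_upto m) * (\<Prod>i<m. 1 - w * w ^ i)) \<longlonglongrightarrow> gf (distinct_strict_partitions k)"
    by (simp add: repeats_upto_0)
qed

section \<open>Multiples of \<open>k\<close> with even multiplicities\<close>

definition even_upto :: "nat \<Rightarrow> nat list set" where
  "even_upto m = {p \<in> even_mult_partitions k. \<forall>n\<in>set p. n \<le> m * k}"

lemma finite_degrees_even_mult: "finite_degrees (even_mult_partitions k)"
  by (rule finite_degrees_subset[OF finite_degrees_no_zero])
     (auto simp: even_mult_partitions_def is_partition_def)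

text \<open>\<open>Suc m * k\<close> is the largest part allowed, so if it occurs it heads the list,
  and by evenness it occurs at least twice.\<close>

lemma even_upto_Suc:
  "even_upto (Suc m) = even_upto m \<union> (\<lambda>p. Suc m * k # Suc m * k # p) ` even_upto (Suc m)" (is "?L = ?R")
proof (intro equalityI subsetI)
  fix p assume p: "p \<in> ?L"
  show "p \<in> ?R"
  proof (cases "\<forall>n\<in>set p. n \<le> m * k")
    case False
    then obtain n where n: "n \<in> set p" "n > m * k" by (auto simp: not_le)
    then obtain j where j: "n = j * k"
      using p by (auto simp: even_upto_def even_mult_partitions_def elim!: dvdE)
    have srt: "sorted_wrt (\<ge>) p" and le: "\<forall>n\<in>set p. n \<le> Suc m * k"
      and ev: "\<forall>n\<in>set p. k dvd n \<and> even (count_list p n)" and nz: "0 \<notin> set p"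
      using p by (auto simp: even_upto_def even_mult_partitions_def is_partition_def)
    \<comment> \<open>The only multiple of \<open>k\<close> above \<open>m * k\<close> and at most
      \<open>Suc m * k\<close> is \<open>Suc m * k\<close> itself.\<close>
    have "m < j" using n(2) unfolding j by simp
    moreover have "j * k \<le> Suc m * k" using le n j by blast
    then have "j \<le> Suc m" using k_pos by (simp del: mult_Suc)
    ultimately have nm: "n = Suc m * k" using j by (metis Suc_leI le_antisym)
    obtain d p1 where p1: "p = d # p1" using n(1) by (cases p) auto
    have d: "d = Suc m * k" using srt p1 n(1) nm le by (auto simp del: mult_Suc intro: le_antisym)
    \<comment> \<open>The head takes one copy of \<open>d\<close> out of an even number, so the tail
      contains another.\<close>
    have "odd (count_list p1 d)" using ev p1 by simp
    then have "d \<in> set p1" by (metis count_notin even_zero)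
    then obtain e q where q: "p1 = e # q" by (cases p1) auto
    have "e = d" using \<open>d \<in> set p1\<close> srt unfolding p1 q by (auto intro: le_antisym)
    then have pq: "p = Suc m * k # Suc m * k # q" using p1 q d by simp
    have "q \<in> ?L"
      using srt le ev nz unfolding pq
      by (auto simp: even_upto_def even_mult_partitions_def is_partition_def simp del: mult_Suc split: if_splits)
    then show ?thesis using pq by blast
  qed (use p in \<open>auto simp: even_upto_def\<close>)
next
  fix p assume "p \<in> ?R"
  then show "p \<in> ?L"
  proof
    assume "p \<in> even_upto m"
    then show ?thesis by (auto simp: even_upto_def)
  next
    assume "p \<in> (\<lambda>p. Suc m * k # Suc m * k # p) ` even_upto (Suc m)"
    then obtain q where p: "p = Suc m * k # Suc m * k # q" and q: "q \<in> even_upto (Suc m)" by blast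
    define c where "c = Suc m * k"
    have q': "sorted_wrt (\<ge>) q" "0 \<notin> set q" "\<forall>n\<in>set q. n \<le> c"
      "\<forall>n\<in>set q. k dvd n \<and> even (count_list q n)"
      using q by (auto simp: c_def even_upto_def even_mult_partitions_def is_partition_def simp del: mult_Suc)
    have c: "k dvd c" "c > 0" using k_pos by (auto simp: c_def simp del: mult_Suc)
    have "even (count_list q c)"
      using q'(4) by (cases "c \<in> set q") auto
    then have "c # c # q \<in> ?L"
      using q' c unfolding even_upto_def even_mult_partitions_def is_partition_def c_def[symmetric] by auto
    then show ?thesis by (simp only: p c_def)
  qed
qed

text \<open>The pair fills the two top rows, so it contributes \<open>w ^ Suc m\<close> and leaves
  the labels below unchanged.\<close>

lemma gf_even_Suc: "gf (even_upto (Suc m)) * (1 - w * w ^ m) = gf (even_upto m)"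
proof -
  let ?h = "\<lambda>p. Suc m * k # Suc m * k # p"
  have fin: "finite_degrees (even_upto (Suc m))"
    by (rule finite_degrees_subset[OF finite_degrees_even_mult]) (auto simp: even_upto_def)
  have "even_upto m \<inter> ?h ` even_upto (Suc m) = {}"
    using k_pos by (auto simp: even_upto_def)
  then have "gf (even_upto (Suc m)) = gf (even_upto m) + gf (?h ` even_upto (Suc m))"
    using gf_Un[of "even_upto m" "?h ` even_upto (Suc m)"] fin
    unfolding even_upto_Suc[of m, symmetric] by blast
  also have "gf (?h ` even_upto (Suc m)) = (w * w ^ m) * gf (even_upto (Suc m))"
    using fin by (rule gf_image) (auto simp: inj_on_def row_weights_multiple simp flip: mult.assoc simp del: mult_Suc)
  finally show ?thesis by (rule recurrence_collect)
qed

text \<open>The product is 1 at every level, since level 0 holds only the empty partition; what lies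
  outside level \<open>m\<close> has a part above \<open>m * k\<close>.\<close>

lemma gf_even_product: "gf (even_mult_partitions k) * qpoch_inf w w = 1"
proof (rule LIMSEQ_unique)
  have "(\<lambda>m. gf (even_upto m)) \<longlonglongrightarrow> gf (even_mult_partitions k)"
  proof (rule gf_tendsto[OF finite_degrees_even_mult])
    fix m p assume "p \<in> even_mult_partitions k - even_upto m"
    then obtain n where n: "n \<in> set p" "n > m * k" by (auto simp: even_upto_def not_le)
    have "m \<le> m * k" using k_pos by simp
    with n member_le_sum_list[of n p] show "m \<le> sum_list p" by linarith
  qed (auto simp: even_upto_def)
  then show "(\<lambda>m. gf (even_upto m) * (\<Prod>i<m. 1 - w * w ^ i)) \<longlonglongrightarrow> gf (even_mult_partitions k) * qpoch_inf w w"
    by (intro tendsto_mult qpoch_inf_limit vanishes_below_zwxy)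
  have "p = []" if "p \<in> even_upto 0" for p
    using that by (cases p) (auto simp: even_upto_def even_mult_partitions_def is_partition_def)
  then have "even_upto 0 = {[]}"
    by (auto simp: even_upto_def even_mult_partitions_def is_partition_def)
  then have "gf (even_upto 0) = 1" by (simp add: gf_def)
  then have "gf (even_upto m) * (\<Prod>i<m. 1 - w * w ^ i) = 1" for m
  proof (induction m)
    case (Suc m)
    have "gf (even_upto (Suc m)) * (\<Prod>i<Suc m. 1 - w * w ^ i) =
        (gf (even_upto (Suc m)) * (1 - w * w ^ m)) * (\<Prod>i<m. 1 - w * w ^ i)"
      by (simp add: ac_simps)
    with Suc show ?case by (simp add: gf_even_Suc del: prod.lessThan_Suc)
  qed simp
  then show "(\<lambda>m. gf (even_upto m) * (\<Prod>i<m. 1 - w * w ^ i)) \<longlonglongrightarrow> 1" by simp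
qed

section \<open>Quotient form of the three identities\<close>

lemma has_sum_formulas:
  "(weight k a b has_sum 1 / qpoch_inf w w) (even_mult_partitions k)"
  "(weight k a b has_sum
      qpoch_inf (- x) w * qpoch_inf (- y) w / (qpoch_inf z w * qpoch_inf w w)) (strict_partitions k)"
  "(weight k a b has_sum
      qpoch_inf (- x) w * qpoch_inf (- y) w / qpoch_inf z w) (distinct_strict_partitions k)"
proof -
  note v = vanishes_below_zwxy
  have unit: "vanishes_below 1 (1 - qpoch_inf w w)" "vanishes_below 1 (1 - qpoch_inf z w)"
    by (intro qpoch_inf_limit v)+
  \<comment> \<open>The two factors are viewed as a product indexed by \<open>bool\<close>.\<close>
  have unit2: "vanishes_below 1 (1 - qpoch_inf z w * qpoch_inf w w)"
    using vanishes_below_one_minus_prod[of UNIV "\<lambda>c. if c then qpoch_inf z w else qpoch_inf w w"] unit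
    by (simp add: UNIV_bool ac_simps)
  \<comment> \<open>The factor \<open>qpoch_inf w w\<close> is exactly what turns the sum over
    strict partitions into the one over distinct parts.\<close>
  have distinct: "gf (distinct_strict_partitions k) * qpoch_inf z w = qpoch_inf (- x) w * qpoch_inf (- y) w"
    using gf_strict_product gf_strict_distinct by (metis mult.assoc mult.commute)
  have eqs: "1 / qpoch_inf w w = gf (even_mult_partitions k)"
    "qpoch_inf (- x) w * qpoch_inf (- y) w / (qpoch_inf z w * qpoch_inf w w) = gf (strict_partitions k)"
    "qpoch_inf (- x) w * qpoch_inf (- y) w / qpoch_inf z w = gf (distinct_strict_partitions k)"
    by (intro divide_eqI unit unit2 gf_even_product gf_strict_product distinct)+
  have "finite_degrees (distinct_strict_partitions k)"
    by (rule finite_degrees_subset[OF finite_degrees_strict_partitions])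
       (auto simp: strict_partitions_def distinct_strict_partitions_def)
  then show "(weight k a b has_sum 1 / qpoch_inf w w) (even_mult_partitions k)"
    "(weight k a b has_sum
      qpoch_inf (- x) w * qpoch_inf (- y) w / (qpoch_inf z w * qpoch_inf w w)) (strict_partitions k)"
    "(weight k a b has_sum
      qpoch_inf (- x) w * qpoch_inf (- y) w / qpoch_inf z w) (distinct_strict_partitions k)"
    unfolding eqs
    by (intro has_sum_gf finite_degrees_even_mult finite_degrees_strict_partitions; assumption)+
qed

end

theorem theorem2p5:
  fixes k :: nat
    and a b :: "nat \<Rightarrow> (indet, 'a::comm_ring_1) mfps"
    and z w x y :: "(indet, 'a) mfps"
  assumes "k \<ge> 1"
  defines "a \<equiv> \<lambda>i. mfps_var (VarA i)"
    and "b \<equiv> \<lambda>i. mfps_var (VarB i)"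
  defines "z \<equiv> \<Prod>i=1..k. a i"
    and "w \<equiv> \<Prod>i=1..k. a i * b i"
    and "x \<equiv> \<Sum>j=1..k-1. \<Prod>i=1..j. a i"
  defines "y \<equiv> z * (\<Sum>j=1..k-1. \<Prod>i=1..j. b i)"
  shows "(weight k a b has_sum 1 / qpoch_inf w w) (even_mult_partitions k)
    \<and> (weight k a b has_sum
            qpoch_inf (- x) w * qpoch_inf (- y) w / (qpoch_inf z w * qpoch_inf w w))
          (strict_partitions k)
    \<and> (weight k a b has_sum
            qpoch_inf (- x) w * qpoch_inf (- y) w / qpoch_inf z w)
          (distinct_strict_partitions k)"
proof -
  interpret labels: row_labels k a b
    by unfold_locales (use assms(1) in \<open>simp_all only: a_def b_def vanishes_below_var\<close>)
  \<comment> \<open>All rows in these four expressions have length at most \<open>k\<close>, so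
    their weights are the plain products of the statement.\<close>
  have z: "labels.z = z"
    by (simp add: labels.z_def z_def row_weight_eq_prod)
  have w: "labels.w = w"
    by (simp add: labels.w_def w_def row_weight_eq_prod prod.distrib)
  have x: "labels.x = x"
    unfolding labels.x_def x_def by (intro sum.cong row_weight_eq_prod) auto
  have y: "labels.y = y"
    unfolding labels.y_def y_def z by (intro arg_cong2[of _ _ _ _ "(*)"] sum.cong row_weight_eq_prod) auto
  show ?thesis
    using labels.has_sum_formulas unfolding z w x y by blast
qed

end
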